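(* Let $O,Y$ be Hilbert spaces, $Z$ a space intermediate between $O$ and $Y$, $a$ a bilinear form, $A:Y\to O$ its associated Fredholm operator, and $(X_n)$ finite dimensional spaces with symmetric bilinear forms $a_n$, as described in the context. Suppose that $A$ is injective. Suppose moreover: (Consistency) there is a dense subset $Y^\infty$ of $Y$ such that for all $u\in Y^\infty$ there is a sequence $u_n\in X_n$ such that $u_n\to u$ in $O$ and $$\lim_{n\to\infty}\ \sup_{v\in X_n\setminus\{0\}}\frac{|a(u,v)-a_n(u_n,v)|}{\|v\|_Z}=0;$$ (Weak stability) there is $\beta>0$ such that for all $n$ $$\inf_{u\in X_n\setminus\{0\}}\ \sup_{v\in X_n\setminus\{0\}}\frac{|a_n(u,v)|}{|u|\,\|v\|_Z}\ge\beta .$$ Let $K:O\to Y$ be the inverse of $A$, i.e. $a(Ku,v)=\langle u,v\rangle$ for all $u,v\in O$, and let $K_n:O\to X_n$ be defined by $a_n(K_nu,v)=\langle u,v\rangle$ for all $u\in O$ and $v\in X_n$. Then $$\|K-K_n\|_{O\to O}\to0\quad\text{as }n\to\infty .$$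
   Context: $O$ is a separable Hilbert space with scalar product $\langle\cdot,\cdot\rangle$ and norm $|\cdot|$. $Y$ is a Hilbert space which is dense and compactly embedded in $O$. $a$ is a bilinear form which is continuous and symmetric on $Y\times Y$ and extends continuously to $Y\times O$ and $O\times Y$. The operator $A:Y\to O$ is defined by $\langle Au,v\rangle=a(u,v)$ for $u\in Y$, $v\in O$, and is assumed to be Fredholm (its index is then $0$ by symmetry). $Z$ is a space, with norm $\|\cdot\|_Z$, intermediate between $O$ and $Y$, i.e. $Y\subseteq Z\subseteq O$ with continuous inclusions, and the injection $Z\to O$ is compact. For each $n\in\mathbb N$, $X_n$ is a finite dimensional subspace of $O$ with $X_n\subseteq Z$, equipped with a symmetric bilinear form $a_n$. It is not assumed that $X_n\subseteq Y$.
   Formalization: That the Fredholm operator A has index 0 is taken as a hypothesis: it does not follow from symmetry (e.g. A = -d²/dx² on H²_0(0,1) in L²(0,1) is injective of index -2), and without it the inverse K: O→Y does not exist. *)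

theory Defs
  imports "HOL-Analysis.Analysis"
begin

text \<open>
  The spaces \<open>Y \<subseteq> Z \<subseteq> O\<close> carry three different topologies, so they are three types related by
  injective linear maps. A subset of \<open>O\<close> is contained in \<open>Z\<close> if it lies in the range of the
  map \<open>Z \<Rightarrow> O\<close>.
\<close>

definition continuous_embedding ::
  "('a::real_normed_vector \<Rightarrow> 'b::real_normed_vector) \<Rightarrow> bool" where
  "continuous_embedding j \<longleftrightarrow> bounded_linear j \<and> inj j"

definition compact_embedding ::
  "('a::real_normed_vector \<Rightarrow> 'b::real_normed_vector) \<Rightarrow> bool" where
  "compact_embedding j \<longleftrightarrow>
     continuous_embedding j \<and> (\<forall>B. bounded B \<longrightarrow> compact (closure (j ` B)))"

text \<open>The norm of the smaller space, for elements of the larger one; only meaningful on the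
  range of the embedding \<open>j\<close>.\<close>

definition norm_via ::
  "('a::real_normed_vector \<Rightarrow> 'b::real_normed_vector) \<Rightarrow> 'b \<Rightarrow> real" where
  "norm_via j v = norm (inv j v)"

definition finite_dim_subspace :: "'a::real_vector set \<Rightarrow> bool" where
  "finite_dim_subspace V \<longleftrightarrow> subspace V \<and> (\<exists>B. finite B \<and> span B = V)"

definition finite_codim_subspace :: "'a::real_vector set \<Rightarrow> bool" where
  "finite_codim_subspace V \<longleftrightarrow> subspace V \<and> (\<exists>B. finite B \<and> span (V \<union> B) = UNIV)"

text \<open>The dimension of the quotient by \<open>V\<close>; only meaningful if \<open>V\<close> has finite codimension.\<close>

definition codim :: "'a::real_vector set \<Rightarrow> nat" where
  "codim V = (LEAST k. \<exists>B. finite B \<and> card B = k \<and> span (V \<union> B) = UNIV)"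

definition fredholm :: "('a::real_normed_vector \<Rightarrow> 'b::real_normed_vector) \<Rightarrow> bool" where
  "fredholm T \<longleftrightarrow>
     bounded_linear T \<and> finite_dim_subspace {x. T x = 0} \<and>
     closed (range T) \<and> finite_codim_subspace (range T)"

definition fredholm_index :: "('a::real_normed_vector \<Rightarrow> 'b::real_normed_vector) \<Rightarrow> int" where
  "fredholm_index T = int (dim {x. T x = 0}) - int (codim (range T))"

definition symmetric_bilinear_form_on ::
  "'a::real_vector set \<Rightarrow> ('a \<Rightarrow> 'a \<Rightarrow> real) \<Rightarrow> bool" where
  "symmetric_bilinear_form_on V b \<longleftrightarrow>
     (\<forall>u\<in>V. \<forall>v\<in>V. \<forall>w\<in>V. b (u + v) w = b u w + b v w \<and> b w (u + v) = b w u + b w v) \<and>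
     (\<forall>c. \<forall>u\<in>V. \<forall>v\<in>V. b (c *\<^sub>R u) v = c * b u v \<and> b u (c *\<^sub>R v) = c * b u v) \<and>
     (\<forall>u\<in>V. \<forall>v\<in>V. b u v = b v u)"

definition solves_on ::
  "'a::real_inner set \<Rightarrow> ('a \<Rightarrow> 'a \<Rightarrow> real) \<Rightarrow> 'a \<Rightarrow> 'a \<Rightarrow> bool" where
  "solves_on V b u w \<longleftrightarrow> w \<in> V \<and> (\<forall>v\<in>V. b w v = inner u v)"

definition discrete_inverse ::
  "'a::real_inner set \<Rightarrow> ('a \<Rightarrow> 'a \<Rightarrow> real) \<Rightarrow> 'a \<Rightarrow> 'a" where
  "discrete_inverse V b u = (THE w. solves_on V b u w)"

text \<open>
  The suprema and infima below are taken in \<^typ>\<open>ennreal\<close>, so that for \<open>V = {0}\<close> the supremum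
  over the empty set of these nonnegative ratios is \<open>0\<close> and the infimum is \<open>\<infinity>\<close>.
  The maps \<open>i\<close> and \<open>j\<close> are the embeddings of \<open>Y\<close> and of \<open>Z\<close> into \<open>O\<close>; \<open>a\<close> is the form on
  \<open>Y \<times> O\<close>, since the discrete spaces need not be contained in \<open>Y\<close>.
\<close>

definition consistent ::
  "('y::real_normed_vector \<Rightarrow> 'o::real_normed_vector) \<Rightarrow> ('z::real_normed_vector \<Rightarrow> 'o) \<Rightarrow>
   ('y \<Rightarrow> 'o \<Rightarrow> real) \<Rightarrow> (nat \<Rightarrow> 'o set) \<Rightarrow> (nat \<Rightarrow> 'o \<Rightarrow> 'o \<Rightarrow> real) \<Rightarrow> bool" where
  "consistent i j a X an \<longleftrightarrow>
     (\<exists>Yinf. closure Yinf = UNIV \<and>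
       (\<forall>u\<in>Yinf. \<exists>un. (\<forall>n. un n \<in> X n) \<and> un \<longlonglongrightarrow> i u \<and>
          (\<lambda>n. SUP v\<in>X n - {0}. ennreal (\<bar>a u v - an n (un n) v\<bar> / norm_via j v))
            \<longlonglongrightarrow> 0))"

definition weakly_stable ::
  "('z::real_normed_vector \<Rightarrow> 'o::real_normed_vector) \<Rightarrow>
   (nat \<Rightarrow> 'o set) \<Rightarrow> (nat \<Rightarrow> 'o \<Rightarrow> 'o \<Rightarrow> real) \<Rightarrow> bool" where
  "weakly_stable j X an \<longleftrightarrow>
     (\<exists>\<beta>>0. \<forall>n. ennreal \<beta> \<le>
        (INF u\<in>X n - {0}. SUP v\<in>X n - {0}.
           ennreal (\<bar>an n u v\<bar> / (norm u * norm_via j v))))"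

end

theory Submission
  imports Defs
begin

text \<open>
  Writing \<open>|f|'\<close> for the norm of \<open>inner f\<close> in the dual of \<open>Z\<close>, weak stability yields the estimate
  \<open>\<beta> * norm (K\<^sub>n f) \<le> |f|'\<close> uniformly in \<open>n\<close>. With consistency and the density of \<open>Yinf\<close> this gives
  \<open>K\<^sub>n f \<longlonglongrightarrow> K f\<close> for every \<open>f\<close>, hence the same estimate for \<open>K\<close>. As \<open>Z\<close> embeds compactly
  in \<open>O\<close>, the unit ball of \<open>O\<close> has finite \<open>|.|'\<close>-nets, on which the pointwise convergence is
  uniform; the two estimates carry it over to the whole ball.
\<close>

section \<open>Finite-dimensional linear algebra for the discrete problems\<close>

lemma orthogonal_basis_exists:
  fixes V :: "'a::real_inner set"
  assumes "finite_dim_subspace V"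
  obtains C where "finite C" "span C = V" "pairwise orthogonal C" "0 \<notin> C"
proof -
  obtain B where B: "finite B" "span B = V"
    using assms unfolding finite_dim_subspace_def by blast
  obtain C where C: "finite C" "span C = V" "pairwise orthogonal C"
    using basis_orthogonal[OF B(1)] B(2) by metis
  show thesis
  proof
    show "finite (C - {0})" "span (C - {0}) = V" "0 \<notin> C - {0}" using C by auto
    show "pairwise orthogonal (C - {0})" using C(3) by (rule pairwise_subset) blast
  qed
qed

text \<open>The sum is the Riesz representative, in the span of \<open>C\<close>, of a functional
  prescribed by its values \<open>f\<close> on the orthogonal set \<open>C\<close>; only the summand
  \<open>c = d\<close> survives.\<close>

lemma inner_orthogonal_expansion:
  fixes C :: "'a::real_inner set"
  assumes "finite C" "pairwise orthogonal C" "d \<in> C" "d \<noteq> 0"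
  shows "inner (\<Sum>c\<in>C. (f c / inner c c) *\<^sub>R c) d = f d"
proof -
  have "inner (\<Sum>c\<in>C. (f c / inner c c) *\<^sub>R c) d = (\<Sum>c\<in>C. f c / inner c c * inner c d)"
    by (simp add: inner_sum_left)
  also have "\<dots> = (\<Sum>c\<in>C. if c = d then f d else 0)"
  proof (rule sum.cong[OF refl])
    fix c assume "c \<in> C"
    then show "f c / inner c c * inner c d = (if c = d then f d else 0)"
      using assms(2-4) by (auto simp: pairwise_def orthogonal_def)
  qed
  finally show ?thesis using assms(1,3) by simp
qed

text \<open>An injective image of the basis \<open>C\<close> is again independent and has as many
  elements. A vector of \<open>C\<close> outside its span could be added to it, giving an
  independent subset of \<open>span C\<close> larger than \<open>C\<close>.\<close>

lemma linear_inj_on_span_surj: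
  fixes T :: "'a::real_vector \<Rightarrow> 'a"
  assumes "finite C" "independent C" "linear T" "inj_on T (span C)" "T ` C \<subseteq> span C"
  shows "T ` span C = span C"
proof -
  have ind: "independent (T ` C)"
    using linear_independent_injective_image[OF assms(3,2,4)] .
  have card: "card (T ` C) = card C"
    by (rule card_image) (rule inj_on_subset[OF assms(4) span_superset])
  have "C \<subseteq> span (T ` C)"
  proof
    fix x assume x: "x \<in> C"
    show "x \<in> span (T ` C)"
    proof (rule ccontr)
      assume nx: "x \<notin> span (T ` C)"
      then have "x \<notin> T ` C" using span_base[of x "T ` C"] by blast
      then have "card (insert x (T ` C)) = Suc (card C)" using assms(1) card by simp
      moreover have "independent (insert x (T ` C))" using nx ind by (rule independent_insertI)
      moreover have "insert x (T ` C) \<subseteq> span C" using x assms(5) span_base[of x C] by blast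
      ultimately show False
        using independent_span_bound[OF assms(1), of "insert x (T ` C)"] by simp
    qed
  qed
  then have "span C \<subseteq> span (T ` C)" by (rule span_minimal) (rule subspace_span)
  moreover have "span (T ` C) \<subseteq> span C" using assms(5) by (rule span_minimal) (rule subspace_span)
  ultimately show ?thesis using linear_span_image[OF assms(3), of C] by simp
qed

lemma form_zero:
  assumes "symmetric_bilinear_form_on V b" "v \<in> V"
  shows "b v 0 = 0"
proof -
  have "b v (0 *\<^sub>R v) = 0 * b v v"
    using assms unfolding symmetric_bilinear_form_on_def by blast
  then show ?thesis by simp
qed

lemma form_diff:
  assumes "symmetric_bilinear_form_on V b" "subspace V" "u \<in> V" "w \<in> V" "v \<in> V"
  shows "b (u - w) v = b u v - b w v"
proof -
  have "u - w \<in> V" using assms subspace_diff by blast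
  then have "b ((u - w) + w) v = b (u - w) v + b w v"
    using assms unfolding symmetric_bilinear_form_on_def by blast
  then show ?thesis by simp
qed

lemma form_eq_linear_on_span:
  assumes form: "symmetric_bilinear_form_on (span C) b" and f: "linear f"
    and eq: "\<And>c. c \<in> C \<Longrightarrow> b w c = f c" and w: "w \<in> span C" and v: "v \<in> span C"
  shows "b w v = f v"
proof -
  \<comment> \<open>Membership in \<open>span C\<close> is carried through the induction because
    \<open>b\<close> is known to be bilinear only there.\<close>
  have "v \<in> span C \<and> b w v = f v"
    using v
  proof (induction rule: span_induct)
    case base
    have "b w (x + y) = b w x + b w y" if "x \<in> span C" "y \<in> span C" for x y
      using form w that unfolding symmetric_bilinear_form_on_def by blast
    moreover have "b w (c *\<^sub>R x) = c * b w x" if "x \<in> span C" for c x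
      using form w that unfolding symmetric_bilinear_form_on_def by blast
    ultimately show ?case
      using form_zero[OF form w]
      by (auto simp: subspace_def span_zero span_add span_scale linear_0[OF f] linear_add[OF f]
          linear_scale[OF f])
  next
    case (step x)
    then show ?case using eq span_base by blast
  qed
  then show ?thesis by blast
qed

text \<open>The form is represented through the inner product by a linear map \<open>T\<close> of
  \<open>V\<close> into itself. Nondegeneracy makes \<open>T\<close> injective, hence onto
  \<open>V\<close> by finite dimension, and the solution is a preimage of the Riesz representative
  of \<open>inner u\<close>.\<close>

lemma nondegenerate_imp_ex1_solves_on:
  fixes V :: "'a::real_inner set"
  assumes V: "finite_dim_subspace V" and form: "symmetric_bilinear_form_on V b"
    and nondeg: "\<And>w. w \<in> V \<Longrightarrow> (\<And>v. v \<in> V \<Longrightarrow> b w v = 0) \<Longrightarrow> w = 0"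
  shows "\<exists>!w. solves_on V b u w"
proof -
  obtain C where C: "finite C" "span C = V" "pairwise orthogonal C" "0 \<notin> C"
    by (rule orthogonal_basis_exists[OF V])
  have sub: "subspace V" using V by (simp add: finite_dim_subspace_def)
  have form': "symmetric_bilinear_form_on (span C) b" using form C by simp
  have sym: "b x y = b y x" if "x \<in> V" "y \<in> V" for x y
    using form that unfolding symmetric_bilinear_form_on_def by blast
  have ind: "independent C" using C by (intro pairwise_orthogonal_independent)
  \<comment> \<open>For linear \<open>f\<close>, \<open>P f\<close> is its Riesz representative in
    \<open>V\<close>; in particular \<open>P (inner u)\<close> is the orthogonal projection of
    \<open>u\<close> onto \<open>V\<close>.\<close>
  define P where "P f = (\<Sum>c\<in>C. (f c / inner c c) *\<^sub>R c)" for f :: "'a \<Rightarrow> real"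
  have P: "P f \<in> V" for f
    unfolding P_def C(2)[symmetric] by (intro span_sum span_scale span_base)
  have inner_P: "inner (P f) d = f d" if "d \<in> C" for f d
    unfolding P_def using inner_orthogonal_expansion[OF C(1,3) that] that C(4) by metis
  obtain T where T: "linear T" "\<And>c. c \<in> C \<Longrightarrow> T c = P (b c)"
    using linear_independent_extend[OF ind, of "\<lambda>c. P (b c)"] by blast
  have inner_T: "inner (T w) d = b w d" if w: "w \<in> V" and d: "d \<in> C" for w d
  proof -
    have dV: "d \<in> V" using d C(2) span_base by blast
    \<comment> \<open>Extension from the basis to its span acts in the second argument of
      \<open>b\<close>, so \<open>w\<close> is moved there by symmetry.\<close>
    have "b d w = inner (T w) d"
    proof (rule form_eq_linear_on_span[OF form'])
      show "linear (\<lambda>x. inner (T x) d)"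
        using T(1) by (intro linearI) (simp_all add: linear_add linear_scale inner_add_left)
      show "b d c = inner (T c) d" if "c \<in> C" for c
        using that C(2) T(2) inner_P[OF d] sym[OF dV, of c] span_base by metis
    qed (use w dV C(2) in auto)
    then show ?thesis using sym w dV by simp
  qed
  have "T w = 0 \<Longrightarrow> w = 0" if w: "w \<in> V" for w
  proof -
    assume Tw: "T w = 0"
    have "b w v = 0" if "v \<in> V" for v
    proof (rule form_eq_linear_on_span[OF form', where f = "\<lambda>_. 0"])
      show "b w c = 0" if "c \<in> C" for c using inner_T[OF w that] Tw by simp
    qed (use w that C(2) in \<open>auto intro: linear_zero\<close>)
    then show "w = 0" by (rule nondeg[OF w])
  qed
  then have "inj_on T V"
    using linear_inj_on_iff_eq_0[OF T(1) sub] by blast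
  then have "T ` V = V"
    using linear_inj_on_span_surj[OF C(1) ind T(1)] T(2) P C(2) by (metis image_subsetI)
  then obtain w where w: "w \<in> V" "T w = P (inner u)" using P by (metis imageE)
  show ?thesis
  proof (rule ex1I[of _ w])
    show "solves_on V b u w"
      unfolding solves_on_def
    proof (intro conjI ballI)
      show "w \<in> V" by fact
      fix v assume "v \<in> V"
      show "b w v = inner u v"
      proof (rule form_eq_linear_on_span[OF form'])
        show "linear (inner u)" by (rule bounded_linear.linear[OF bounded_linear_inner_right])
        show "b w c = inner u c" if "c \<in> C" for c
          using inner_T[OF w(1) that] inner_P[OF that] w(2) by simp
      qed (use w \<open>v \<in> V\<close> C(2) in auto)
    qed
    fix w' assume w': "solves_on V b u w'"
    have "w' - w = 0"
    proof (rule nondeg)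
      show "w' - w \<in> V" using sub w' w(1) by (simp add: solves_on_def subspace_diff)
      show "b (w' - w) v = 0" if "v \<in> V" for v
        using w' \<open>solves_on V b u w\<close> that form_diff[OF form sub, of w' w v]
        by (simp add: solves_on_def)
    qed
    then show "w' = w" by simp
  qed
qed

lemma discrete_inverse_eqI:
  assumes "\<exists>!w. solves_on V b u w" "solves_on V b u w"
  shows "discrete_inverse V b u = w"
  unfolding discrete_inverse_def using assms by (rule the1_equality)

lemma solves_on_discrete_inverse:
  assumes "\<exists>!w. solves_on V b u w"
  shows "solves_on V b u (discrete_inverse V b u)"
  unfolding discrete_inverse_def using assms by (rule theI')

lemma linear_discrete_inverse:
  assumes sub: "subspace V" and form: "symmetric_bilinear_form_on V b"
    and ex1: "\<And>u. \<exists>!w. solves_on V b u w"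
  shows "linear (discrete_inverse V b)"
proof (rule linearI)
  note S = solves_on_discrete_inverse[OF ex1, unfolded solves_on_def]
  show "discrete_inverse V b (x + y) = discrete_inverse V b x + discrete_inverse V b y" for x y
  proof (rule discrete_inverse_eqI[OF ex1])
    have "b (discrete_inverse V b x + discrete_inverse V b y) v =
        b (discrete_inverse V b x) v + b (discrete_inverse V b y) v" if "v \<in> V" for v
      using form that S unfolding symmetric_bilinear_form_on_def by blast
    then show "solves_on V b (x + y) (discrete_inverse V b x + discrete_inverse V b y)"
      using S sub by (simp add: solves_on_def subspace_add inner_add_left)
  qed
  show "discrete_inverse V b (r *\<^sub>R x) = r *\<^sub>R discrete_inverse V b x" for r x
  proof (rule discrete_inverse_eqI[OF ex1])
    have "b (r *\<^sub>R discrete_inverse V b x) v = r * b (discrete_inverse V b x) v" if "v \<in> V" for v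
      using form that S unfolding symmetric_bilinear_form_on_def by blast
    then show "solves_on V b (r *\<^sub>R x) (r *\<^sub>R discrete_inverse V b x)"
      using S sub by (simp add: solves_on_def subspace_scale)
  qed
qed

section \<open>Stability and consistency as real inequalities\<close>

text \<open>The inf-sup bound in the form used below: any bound \<open>M\<close> on the functional
  \<open>an n u\<close> in the dual norm controls the norm of \<open>u\<close>, because it bounds
  each quotient in the supremum by \<open>M / norm u\<close>.\<close>

lemma weakly_stable_obtains:
  assumes "weakly_stable j X an"
  obtains \<beta> where "\<beta> > 0"
    and "\<And>n u M. u \<in> X n \<Longrightarrow> 0 \<le> M \<Longrightarrow> (\<And>v. v \<in> X n \<Longrightarrow> \<bar>an n u v\<bar> \<le> M * norm_via j v)
      \<Longrightarrow> \<beta> * norm u \<le> M"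
proof -
  obtain \<beta> where \<beta>: "\<beta> > 0" and le: "\<And>n. ennreal \<beta> \<le>
      (INF u\<in>X n - {0}. SUP v\<in>X n - {0}. ennreal (\<bar>an n u v\<bar> / (norm u * norm_via j v)))"
    using assms unfolding weakly_stable_def by blast
  show thesis
  proof (rule that[OF \<beta>])
    fix n u M
    assume u: "u \<in> X n" and M: "0 \<le> M"
      and bd: "\<And>v. v \<in> X n \<Longrightarrow> \<bar>an n u v\<bar> \<le> M * norm_via j v"
    show "\<beta> * norm u \<le> M"
    proof (cases "u = 0")
      case False
      have "ennreal \<beta> \<le> (SUP v\<in>X n - {0}. ennreal (\<bar>an n u v\<bar> / (norm u * norm_via j v)))"
        using u False by (intro order_trans[OF le[of n] INF_lower]) auto
      also have "\<dots> \<le> ennreal (M / norm u)"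
      proof (intro SUP_least ennreal_leI)
        fix v assume v: "v \<in> X n - {0}"
        show "\<bar>an n u v\<bar> / (norm u * norm_via j v) \<le> M / norm u"
        proof (cases "norm_via j v = 0")
          \<comment> \<open>Division by zero gives 0, so such a \<open>v\<close> contributes nothing
            to the supremum.\<close>
          case True
          then show ?thesis using M by simp
        next
          case nz: False
          then have "norm_via j v > 0" unfolding norm_via_def by simp
          then show ?thesis using bd[of v] v False by (simp add: divide_simps mult.commute)
        qed
      qed
      finally have "\<beta> \<le> M / norm u" using M by (simp add: ennreal_le_iff)
      then show ?thesis using False by (simp add: pos_le_divide_eq)
    qed (use M in simp)
  qed
qed

text \<open>A limit of suprema in \<open>ennreal\<close> becomes an eventual real inequality for all
  \<open>v\<close> at once, with the denominator cleared so that \<open>v = 0\<close> is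
  included.\<close>

lemma consistentD:
  assumes "consistent i j a X an" "linear j" "inj j" "\<And>n. X n \<subseteq> range j"
    and "\<And>u. a u 0 = 0" "\<And>n. symmetric_bilinear_form_on (X n) (an n)"
  obtains Yinf where "closure Yinf = UNIV"
    and "\<And>u. u \<in> Yinf \<Longrightarrow> \<exists>un. (\<forall>n. un n \<in> X n) \<and> un \<longlonglongrightarrow> i u \<and>
      (\<forall>e>0. \<forall>\<^sub>F n in sequentially. \<forall>v\<in>X n. \<bar>a u v - an n (un n) v\<bar> \<le> e * norm_via j v)"
proof -
  obtain Yinf where "closure Yinf = UNIV" and Y: "\<And>u. u \<in> Yinf \<Longrightarrow>
      \<exists>un. (\<forall>n. un n \<in> X n) \<and> un \<longlonglongrightarrow> i u \<and>
          (\<lambda>n. SUP v\<in>X n - {0}. ennreal (\<bar>a u v - an n (un n) v\<bar> / norm_via j v)) \<longlonglongrightarrow> 0"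
    using assms(1) unfolding consistent_def by blast
  show thesis
  proof (rule that[OF \<open>closure Yinf = UNIV\<close>])
    fix u assume "u \<in> Yinf"
    then obtain un where un: "\<And>n. un n \<in> X n" "un \<longlonglongrightarrow> i u"
      and lim: "(\<lambda>n. SUP v\<in>X n - {0}. ennreal (\<bar>a u v - an n (un n) v\<bar> / norm_via j v)) \<longlonglongrightarrow> 0"
      using Y by blast
    have "\<forall>\<^sub>F n in sequentially. \<forall>v\<in>X n. \<bar>a u v - an n (un n) v\<bar> \<le> e * norm_via j v"
      if e: "e > 0" for e
    proof -
      have "\<forall>\<^sub>F n in sequentially.
          (SUP v\<in>X n - {0}. ennreal (\<bar>a u v - an n (un n) v\<bar> / norm_via j v)) < ennreal e"
        using order_tendstoD(2)[OF lim] e by simp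
      then show ?thesis
      proof eventually_elim
        case (elim n)
        show ?case
        proof
          fix v assume v: "v \<in> X n"
          show "\<bar>a u v - an n (un n) v\<bar> \<le> e * norm_via j v"
          proof (cases "v = 0")
            case True
            then show ?thesis
              using assms(5) form_zero[OF assms(6) un(1)] e by (simp add: norm_via_def)
          next
            case False
            \<comment> \<open>On the range of \<open>j\<close>, a nonzero \<open>v\<close> has a
              nonzero preimage, so the denominator is positive and can be cleared.\<close>
            have "j (inv j v) = v" using v assms(4) by (meson f_inv_into_f subsetD)
            then have pos: "norm_via j v > 0"
              using False linear_0[OF assms(2)] by (auto simp: norm_via_def)
            have "ennreal (\<bar>a u v - an n (un n) v\<bar> / norm_via j v) \<le> ennreal e"
              using v False by (intro order_trans[OF SUP_upper less_imp_le[OF elim]]) auto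
            then have "\<bar>a u v - an n (un n) v\<bar> / norm_via j v \<le> e"
              using e by (simp add: ennreal_le_iff)
            then show ?thesis using pos by (simp add: pos_divide_le_eq)
          qed
        qed
      qed
    qed
    then show "\<exists>un. (\<forall>n. un n \<in> X n) \<and> un \<longlonglongrightarrow> i u \<and>
      (\<forall>e>0. \<forall>\<^sub>F n in sequentially. \<forall>v\<in>X n. \<bar>a u v - an n (un n) v\<bar> \<le> e * norm_via j v)"
      using un by blast
  qed
qed

section \<open>Finite nets for the unit ball in a dual norm\<close>

text \<open>Each inner product with \<open>c\<close> is rounded down to a multiple of
  \<open>e\<close>. Since it is bounded by \<open>norm c\<close> on the unit ball, only finitely
  many rounding patterns \<open>h f\<close> occur, and vectors with the same pattern differ by at
  most \<open>e\<close> against every \<open>c\<close>.\<close>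

lemma finite_net_inner:
  fixes C :: "'a::real_inner set"
  assumes "finite C" "e > 0"
  obtains F where "finite F" "F \<subseteq> cball 0 1"
    "\<And>f. f \<in> cball 0 1 \<Longrightarrow> \<exists>g\<in>F. \<forall>c\<in>C. \<bar>inner (f - g) c\<bar> \<le> e"
proof -
  define h where "h f = (\<lambda>c\<in>C. \<lfloor>inner f c / e\<rfloor>)" for f
  have "h ` cball 0 1 \<subseteq> (\<Pi>\<^sub>E c\<in>C. {\<lfloor>- norm c / e\<rfloor>..\<lfloor>norm c / e\<rfloor>})"
  proof (intro image_subsetI PiE_I)
    fix f :: 'a and c assume f: "f \<in> cball 0 1" and c: "c \<in> C"
    have "\<bar>inner f c\<bar> \<le> norm f * norm c" by (rule Cauchy_Schwarz_ineq2)
    also have "\<dots> \<le> norm c" using f by (simp add: mult_left_le_one_le)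
    finally have "- norm c \<le> inner f c" "inner f c \<le> norm c" by auto
    then have "- norm c / e \<le> inner f c / e" "inner f c / e \<le> norm c / e"
      using assms(2) by (simp_all only: divide_right_mono less_imp_le)
    then show "h f c \<in> {\<lfloor>- norm c / e\<rfloor>..\<lfloor>norm c / e\<rfloor>}"
      using c by (simp only: h_def restrict_apply' atLeastAtMost_iff floor_mono)
  qed (simp add: h_def)
  then have "finite (h ` cball 0 1)"
    by (rule finite_subset) (intro finite_PiE assms(1) finite_atLeastAtMost_int)
  \<comment> \<open>\<open>F\<close> contains representatives of all rounding patterns that
    occur.\<close>
  then obtain F where F: "F \<subseteq> cball 0 1" "finite F" "h ` cball 0 1 = h ` F"
    using finite_subset_image[of "h ` cball 0 1" h "cball 0 1"] by auto
  show thesis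
  proof (rule that[OF F(2,1)])
    fix f :: 'a assume "f \<in> cball 0 1"
    then obtain g where g: "g \<in> F" "h f = h g" using F(3) by (metis imageE imageI)
    have "\<bar>inner (f - g) c\<bar> \<le> e" if "c \<in> C" for c
    proof -
      have "\<lfloor>inner f c / e\<rfloor> = \<lfloor>inner g c / e\<rfloor>"
        using fun_cong[OF g(2), of c] that by (simp add: h_def)
      then have "\<bar>inner f c / e - inner g c / e\<bar> \<le> 1" by linarith
      then have "\<bar>inner f c - inner g c\<bar> / e \<le> 1"
        using assms(2) by (simp add: diff_divide_distrib[symmetric])
      then show ?thesis using assms(2) by (simp add: inner_diff_left)
    qed
    then show "\<exists>g\<in>F. \<forall>c\<in>C. \<bar>inner (f - g) c\<bar> \<le> e" using g(1) by blast
  qed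
qed

text \<open>Schauder's theorem for \<open>j\<close>: the unit ball of \<open>O\<close> is totally bounded in the dual norm of
  \<open>Z\<close>, the smallest \<open>M \<ge> 0\<close> such that \<open>\<bar>inner f (j z)\<bar> \<le> M * norm z\<close> for all \<open>z\<close>.\<close>

lemma compact_embedding_dual_net:
  fixes j :: "'z::real_normed_vector \<Rightarrow> 'o::real_inner"
  assumes "compact_embedding j" "e > 0"
  obtains F where "finite F" "F \<subseteq> cball 0 1"
    "\<And>f. f \<in> cball 0 1 \<Longrightarrow> \<exists>g\<in>F. \<forall>z. \<bar>inner (f - g) (j z)\<bar> \<le> e * norm z"
proof -
  have lin: "linear j"
    using assms(1) by (simp add: compact_embedding_def continuous_embedding_def bounded_linear.linear)
  have "compact (closure (j ` cball 0 1))"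
    using assms(1) bounded_cball unfolding compact_embedding_def by blast
  then have "compact (closure (j ` cball 0 1)) \<and> e / 4 > 0" using assms(2) by simp
  \<comment> \<open>Two vectors of the unit ball are at distance at most 2, so replacing
    \<open>j z\<close> by a centre costs at most \<open>2 * (e / 4)\<close>; the other half of
    \<open>e\<close> is left for the net on \<open>C\<close>.\<close>
  then obtain C where C: "finite C" "closure (j ` cball 0 1) \<subseteq> (\<Union>c\<in>C. ball c (e / 4))"
    using compact_eq_totally_bounded by metis
  obtain F where F: "finite F" "F \<subseteq> cball 0 1"
    "\<And>f. f \<in> cball 0 1 \<Longrightarrow> \<exists>g\<in>F. \<forall>c\<in>C. \<bar>inner (f - g) c\<bar> \<le> e / 2"
    using finite_net_inner[OF C(1), of "e / 2"] assms(2) by auto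
  show thesis
  proof (rule that[OF F(1,2)])
    fix f :: 'o assume f: "f \<in> cball 0 1"
    then obtain g where g: "g \<in> F" "\<And>c. c \<in> C \<Longrightarrow> \<bar>inner (f - g) c\<bar> \<le> e / 2"
      using F(3) by blast
    have fg: "norm (f - g) \<le> 2"
      using f g(1) F(2) norm_triangle_ineq4[of f g] by fastforce
    have unit: "\<bar>inner (f - g) (j z)\<bar> \<le> e" if "norm z \<le> 1" for z
    proof -
      have "j z \<in> closure (j ` cball 0 1)" using that closure_subset by fastforce
      then obtain c where c: "c \<in> C" "dist c (j z) < e / 4" using C(2) by auto
      have "\<bar>inner (f - g) (j z - c)\<bar> \<le> norm (f - g) * norm (j z - c)"
        by (rule Cauchy_Schwarz_ineq2)
      also have "\<dots> \<le> 2 * (e / 4)"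
        using fg c(2) by (intro mult_mono) (auto simp: dist_norm norm_minus_commute)
      finally show ?thesis using g(2)[OF c(1)] unfolding inner_diff_right by linarith
    qed
    have "\<bar>inner (f - g) (j z)\<bar> \<le> e * norm z" for z
    proof (cases "z = 0")
      case False
      have "\<bar>inner (f - g) (j ((1 / norm z) *\<^sub>R z))\<bar> \<le> e" by (rule unit) simp
      then have "\<bar>inner (f - g) (j z)\<bar> / norm z \<le> e"
        by (simp add: linear_scale[OF lin] abs_mult)
      then show ?thesis using False by (simp add: pos_divide_le_eq)
    qed (use linear_0[OF lin] in simp)
    then show "\<exists>g\<in>F. \<forall>z. \<bar>inner (f - g) (j z)\<bar> \<le> e * norm z" using g(1) by blast
  qed
qed

section \<open>Invertibility of the continuous operator\<close>

text \<open>A trivial kernel and index 0 force codimension 0. Finite codimension ensures that the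
  \<open>LEAST\<close> in \<open>codim\<close> is attained, here by the empty set, so the range
  already spans the whole space.\<close>

lemma fredholm_index_zero_inj_imp_bij:
  assumes "fredholm T" "fredholm_index T = 0" "inj T"
  shows "bij T"
proof -
  have lin: "linear T" using assms(1) by (simp add: fredholm_def bounded_linear.linear)
  have sub: "subspace (range T)" using assms(1) by (simp add: fredholm_def finite_codim_subspace_def)
  have "{x. T x = 0} = {0}" using assms(3) linear_0[OF lin] linear_injective_0[OF lin] by auto
  moreover have "dim {0 :: 'a} = 0"
    using dim_span[of "{} :: 'a set"] dim_eq_card_independent[OF independent_empty] by simp
  ultimately have 0: "codim (range T) = 0" using assms(2) by (simp add: fredholm_index_def)
  have "\<exists>k B. finite B \<and> card B = k \<and> span (range T \<union> B) = UNIV"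
    using assms(1) unfolding fredholm_def finite_codim_subspace_def by blast
  then have "\<exists>B. finite B \<and> card B = codim (range T) \<and> span (range T \<union> B) = UNIV"
    unfolding codim_def by (rule LeastI_ex)
  then have "span (range T) = UNIV" using 0 by auto
  then have "range T = UNIV" using sub span_eq_iff by metis
  then show ?thesis using assms(3) by (simp add: bij_def)
qed

lemma linear_inv_bij:
  assumes "linear f" "bij f"
  shows "linear (inv f)"
proof (rule linearI)
  have f: "f (inv f x) = x" for x using assms(2) by (simp add: bij_is_surj surj_f_inv_f)
  show "inv f (x + y) = inv f x + inv f y" for x y
    by (rule inv_f_eq[OF bij_is_inj[OF assms(2)]]) (simp add: linear_add[OF assms(1)] f)
  show "inv f (r *\<^sub>R x) = r *\<^sub>R inv f x" for r x
    by (rule inv_f_eq[OF bij_is_inj[OF assms(2)]]) (simp add: linear_scale[OF assms(1)] f)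
qed

section \<open>Norm convergence of the discrete inverses\<close>

theorem proposition6p1:
  fixes jYO :: "'y::{real_inner, complete_space} \<Rightarrow> 'o::{real_inner, complete_space}"
    and jYZ :: "'y \<Rightarrow> 'z::real_normed_vector"
    and jZO :: "'z \<Rightarrow> 'o"
    and a :: "'y \<Rightarrow> 'y \<Rightarrow> real"
    and aYO :: "'y \<Rightarrow> 'o \<Rightarrow> real"
    and aOY :: "'o \<Rightarrow> 'y \<Rightarrow> real"
    and A :: "'y \<Rightarrow> 'o"
    and X :: "nat \<Rightarrow> 'o set"
    and an :: "nat \<Rightarrow> 'o \<Rightarrow> 'o \<Rightarrow> real"
  assumes "separable_space (euclidean :: 'o topology)"
    and "compact_embedding jYO" and "closure (range jYO) = UNIV"
    and "continuous_embedding jYZ" and "compact_embedding jZO" and "jYO = jZO \<circ> jYZ"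
    and "bounded_bilinear a" and "\<And>u v. a u v = a v u"
    and "bounded_bilinear aYO" and "\<And>u v. aYO u (jYO v) = a u v"
    and "bounded_bilinear aOY" and "\<And>u v. aOY (jYO u) v = a u v"
    and "\<And>u v. inner (A u) v = aYO u v"
    and "fredholm A" and "fredholm_index A = 0"
    and "\<And>n. finite_dim_subspace (X n)" and "\<And>n. X n \<subseteq> range jZO"
    and "\<And>n. symmetric_bilinear_form_on (X n) (an n)"
    and "inj A"
    and "consistent jYO jZO aYO X an"
    and "weakly_stable jZO X an"
  shows "bij A \<and> (\<forall>u v. aYO (inv A u) v = inner u v) \<and>
    (\<forall>n u. \<exists>!w. solves_on (X n) (an n) u w) \<and>
    (\<forall>n. bounded_linear (\<lambda>u. jYO (inv A u) - discrete_inverse (X n) (an n) u)) \<and>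
    (\<lambda>n. onorm (\<lambda>u. jYO (inv A u) - discrete_inverse (X n) (an n) u)) \<longlonglongrightarrow> 0"
proof -
  define K where "K = (\<lambda>u. jYO (inv A u))"
  define Kn where "Kn n = discrete_inverse (X n) (an n)" for n
  have bij: "bij A" using assms(14,15,19) by (rule fredholm_index_zero_inj_imp_bij)
  have Ainv: "A (inv A u) = u" for u using bij by (simp add: bij_is_surj surj_f_inv_f)
  have linY: "bounded_linear jYO" and linZ: "bounded_linear jZO" and injZ: "inj jZO"
    using assms(2,5) by (simp_all add: compact_embedding_def continuous_embedding_def)
  have blA: "bounded_linear A" using assms(14) by (simp add: fredholm_def)
  have linA: "linear A" using blA by (rule bounded_linear.linear)
  have sub: "subspace (X n)" for n using assms(16) by (simp add: finite_dim_subspace_def)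
  have linK: "linear K"
    using linear_compose[OF linear_inv_bij[OF linA bij] bounded_linear.linear[OF linY]]
    by (simp add: K_def o_def)

  obtain \<beta> where \<beta>: "\<beta> > 0"
    and stable: "\<And>n u M. u \<in> X n \<Longrightarrow> 0 \<le> M \<Longrightarrow>
      (\<And>v. v \<in> X n \<Longrightarrow> \<bar>an n u v\<bar> \<le> M * norm_via jZO v) \<Longrightarrow> \<beta> * norm u \<le> M"
    using weakly_stable_obtains[OF assms(21)] by blast
  have ex1: "\<exists>!w. solves_on (X n) (an n) u w" for n u
  proof (rule nondegenerate_imp_ex1_solves_on[OF assms(16,18)])
    fix w assume "w \<in> X n" "\<And>v. v \<in> X n \<Longrightarrow> an n w v = 0"
    \<comment> \<open>Stability with \<open>M = 0\<close> is exactly nondegeneracy of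
      \<open>an n\<close> on \<open>X n\<close>.\<close>
    then have "\<beta> * norm w \<le> 0" by (intro stable) auto
    then show "w = 0" using \<beta> by (simp add: mult_le_0_iff)
  qed
  have Kn: "Kn n u \<in> X n" "\<And>v. v \<in> X n \<Longrightarrow> an n (Kn n u) v = inner u v" for n u
    using solves_on_discrete_inverse[OF ex1[of n u]] by (simp_all add: Kn_def solves_on_def)
  have linKn: "linear (Kn n)" for n
    unfolding Kn_def using sub assms(18) ex1 by (rule linear_discrete_inverse)

  \<comment> \<open>The functional \<open>an n (Kn n f)\<close> agrees with \<open>inner f\<close>
    on \<open>X n\<close>, so a dual bound for \<open>f\<close> can be fed into stability.\<close>
  have Kn_dual: "\<beta> * norm (Kn n f) \<le> M"
    if "0 \<le> M" and bd: "\<And>z. \<bar>inner f (jZO z)\<bar> \<le> M * norm z" for n f M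
  proof (rule stable[OF Kn(1) \<open>0 \<le> M\<close>])
    fix v assume v: "v \<in> X n"
    then have "jZO (inv jZO v) = v" using assms(17) by (meson f_inv_into_f subsetD)
    then show "\<bar>an n (Kn n f) v\<bar> \<le> M * norm_via jZO v"
      using bd[of "inv jZO v"] Kn(2)[OF v] by (simp add: norm_via_def)
  qed
  obtain C where C: "C > 0" "\<And>z. norm (jZO z) \<le> norm z * C"
    using bounded_linear.pos_bounded[OF linZ] by blast
  have inner_j: "\<bar>inner f (jZO z)\<bar> \<le> (norm f * C) * norm z" for f z
  proof -
    have "\<bar>inner f (jZO z)\<bar> \<le> norm f * norm (jZO z)" by (rule Cauchy_Schwarz_ineq2)
    also have "\<dots> \<le> norm f * (norm z * C)" by (intro mult_left_mono C(2)) simp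
    finally show ?thesis by (simp add: mult_ac)
  qed
  have Kn_bound: "norm (Kn n f) \<le> norm f * (C / \<beta>)" for n f
  proof -
    have "\<beta> * norm (Kn n f) \<le> norm f * C" using inner_j C(1) by (intro Kn_dual) auto
    then show ?thesis using \<beta> by (simp add: pos_le_divide_eq mult.commute)
  qed

  \<comment> \<open>Pointwise convergence\<close>
  obtain Yinf where dense: "closure Yinf = UNIV"
    and cons: "\<And>u. u \<in> Yinf \<Longrightarrow> \<exists>un. (\<forall>n. un n \<in> X n) \<and> un \<longlonglongrightarrow> jYO u \<and>
      (\<forall>e>0. \<forall>\<^sub>F n in sequentially. \<forall>v\<in>X n. \<bar>aYO u v - an n (un n) v\<bar> \<le> e * norm_via jZO v)"
    using consistentD[OF assms(20) bounded_linear.linear[OF linZ] injZ assms(17)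
        bounded_bilinear.zero_right[OF assms(9)] assms(18)] by blast
  have conv_Yinf: "(\<lambda>n. Kn n (A u)) \<longlonglongrightarrow> jYO u" if "u \<in> Yinf" for u
  proof -
    obtain un where un: "\<And>n. un n \<in> X n" "un \<longlonglongrightarrow> jYO u"
      and ev: "\<And>e. e > 0 \<Longrightarrow> \<forall>\<^sub>F n in sequentially.
        \<forall>v\<in>X n. \<bar>aYO u v - an n (un n) v\<bar> \<le> e * norm_via jZO v"
      using cons[OF \<open>u \<in> Yinf\<close>] by blast
    \<comment> \<open>Tested with \<open>v\<close> in \<open>X n\<close>, this difference yields
      \<open>aYO u v - an n (un n) v\<close>, which is the consistency error; stability turns its
      dual bound into a norm bound.\<close>
    have "(\<lambda>n. Kn n (A u) - un n) \<longlonglongrightarrow> 0"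
    proof (rule tendstoI)
      fix e :: real assume e: "e > 0"
      then have "\<beta> * e / 2 > 0" using \<beta> by simp
      from ev[OF this]
      show "\<forall>\<^sub>F n in sequentially. dist (Kn n (A u) - un n) 0 < e"
      proof eventually_elim
        case (elim n)
        have "\<beta> * norm (Kn n (A u) - un n) \<le> \<beta> * e / 2"
        proof (rule stable)
          show "Kn n (A u) - un n \<in> X n" using sub Kn(1) un(1) by (rule subspace_diff)
          show "0 \<le> \<beta> * e / 2" using \<beta> e by simp
          show "\<bar>an n (Kn n (A u) - un n) v\<bar> \<le> \<beta> * e / 2 * norm_via jZO v" if "v \<in> X n" for v
            using elim that form_diff[OF assms(18) sub Kn(1) un(1) that] Kn(2)[OF that] assms(13)
            by simp
        qed
        then have "norm (Kn n (A u) - un n) \<le> e / 2" using \<beta> by simp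
        then show ?case using e by simp
      qed
    qed
    then have "(\<lambda>n. Kn n (A u) - un n + un n) \<longlonglongrightarrow> 0 + jYO u" using un(2) by (rule tendsto_add)
    then show ?thesis by simp
  qed

  have conv: "(\<lambda>n. Kn n f) \<longlonglongrightarrow> K f" for f
  proof (rule tendstoI)
    fix e :: real assume e: "e > 0"
    define y where "y = inv A f"
    obtain cA where cA: "cA > 0" "\<And>x. norm (A x) \<le> norm x * cA"
      using bounded_linear.pos_bounded[OF blA] by blast
    obtain cY where cY: "cY > 0" "\<And>x. norm (jYO x) \<le> norm x * cY"
      using bounded_linear.pos_bounded[OF linY] by blast
    \<comment> \<open>\<open>q\<close> bounds the total cost, per unit of
      \<open>norm (y - u)\<close>, of replacing \<open>y\<close> by \<open>u\<close>: the first
      summand for \<open>Kn n (A (y - u))\<close>, uniformly in \<open>n\<close>, the second for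
      \<open>jYO (y - u)\<close>.\<close>
    define q where "q = cA * (C / \<beta>) + cY"
    have q: "q > 0" using cA cY C \<beta> by (simp add: q_def add_pos_pos)
    have "y \<in> closure Yinf" using dense by simp
    then obtain u where u: "u \<in> Yinf" "dist u y < e / (2 * q)"
      using e q closure_approachable[of y Yinf] by (meson divide_pos_pos mult_pos_pos zero_less_numeral)
    have small: "norm (y - u) * q < e / 2"
      using u(2) q by (simp add: dist_norm norm_minus_commute field_simps)
    have "\<forall>\<^sub>F n in sequentially. dist (Kn n (A u)) (jYO u) < e / 2"
      using tendstoD[OF conv_Yinf[OF u(1)], of "e / 2"] e by simp
    then show "\<forall>\<^sub>F n in sequentially. dist (Kn n f) (K f) < e"
    proof eventually_elim
      case (elim n)
      have split: "Kn n f - K f = Kn n (A (y - u)) + (Kn n (A u) - jYO u) - jYO (y - u)"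
        by (simp add: K_def y_def Ainv linear_diff[OF linA] linear_diff[OF linKn]
            linear_diff[OF bounded_linear.linear[OF linY]])
      have "norm (Kn n (A (y - u))) \<le> norm (A (y - u)) * (C / \<beta>)" by (rule Kn_bound)
      also have "\<dots> \<le> (norm (y - u) * cA) * (C / \<beta>)"
        using cA(2) C(1) \<beta> by (intro mult_right_mono) auto
      finally have "norm (Kn n (A (y - u))) + norm (jYO (y - u)) \<le> norm (y - u) * q"
        using cY(2)[of "y - u"] by (simp add: q_def algebra_simps)
      moreover have "norm (Kn n f - K f) \<le>
          norm (Kn n (A (y - u))) + norm (Kn n (A u) - jYO u) + norm (jYO (y - u))"
        unfolding split by norm
      ultimately show ?case using small elim by (simp add: dist_norm)
    qed
  qed

  \<comment> \<open>The estimate for \<open>Kn n\<close> has constants independent of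
    \<open>n\<close>, so it survives the pointwise limit; \<open>K_bound\<close> below inherits
    continuity of \<open>K\<close> on \<open>O\<close> in this way.\<close>
  have K_dual: "\<beta> * norm (K f) \<le> M"
    if "0 \<le> M" "\<And>z. \<bar>inner f (jZO z)\<bar> \<le> M * norm z" for f M
  proof (rule LIMSEQ_le_const2)
    show "(\<lambda>n. \<beta> * norm (Kn n f)) \<longlonglongrightarrow> \<beta> * norm (K f)"
      by (intro tendsto_intros conv)
    show "\<exists>N. \<forall>n\<ge>N. \<beta> * norm (Kn n f) \<le> M" using Kn_dual[OF that] by blast
  qed
  have lin_diff: "linear (\<lambda>u. K u - Kn n u)" for n
    using linK linKn by (rule linear_compose_sub)
  have K_bound: "norm (K f) \<le> norm f * (C / \<beta>)" for f
  proof -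
    have "\<beta> * norm (K f) \<le> norm f * C" using inner_j C(1) by (intro K_dual) auto
    then show ?thesis using \<beta> by (simp add: pos_le_divide_eq mult.commute)
  qed
  have bl: "bounded_linear (\<lambda>u. K u - Kn n u)" for n
  proof (rule bounded_linear_intro[where K = "C / \<beta> + C / \<beta>"])
    show "norm (K f - Kn n f) \<le> norm f * (C / \<beta> + C / \<beta>)" for f
      using norm_triangle_ineq4[of "K f" "Kn n f"] K_bound[of f] Kn_bound[of n f]
      unfolding distrib_left by linarith
  qed (use linear_add[OF lin_diff] linear_scale[OF lin_diff] in auto)

  \<comment> \<open>From pointwise to uniform convergence\<close>
  have onorm_lim: "(\<lambda>n. onorm (\<lambda>u. K u - Kn n u)) \<longlonglongrightarrow> 0"
  proof (rule tendstoI)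
    fix e :: real assume e: "e > 0"
    \<comment> \<open>Chosen so that a vector of dual norm at most \<open>d\<close> is mapped by
      both \<open>K\<close> and \<open>Kn n\<close> to norm at most \<open>e / 4\<close>.\<close>
    define d where "d = \<beta> * (e / 4)"
    have d: "d > 0" using e \<beta> by (simp add: d_def)
    obtain F where F: "finite F"
      "\<And>f. f \<in> cball 0 1 \<Longrightarrow> \<exists>g\<in>F. \<forall>z. \<bar>inner (f - g) (jZO z)\<bar> \<le> d * norm z"
      using compact_embedding_dual_net[OF assms(5) d] by metis
    have "\<forall>\<^sub>F n in sequentially. \<forall>g\<in>F. dist (Kn n g) (K g) < e / 4"
      using F(1) tendstoD[OF conv, of "e / 4"] e by (intro eventually_ball_finite) auto
    then show "\<forall>\<^sub>F n in sequentially. dist (onorm (\<lambda>u. K u - Kn n u)) 0 < e"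
    proof eventually_elim
      case (elim n)
      have unit: "norm (K f - Kn n f) \<le> 3 / 4 * e" if f: "norm f \<le> 1" for f
      proof -
        obtain g where g: "g \<in> F" "\<And>z. \<bar>inner (f - g) (jZO z)\<bar> \<le> d * norm z"
          using F(2)[of f] f by auto
        \<comment> \<open>The outer terms are small by the dual estimates, the middle one by
          convergence on the finite net. The total \<open>3 / 4 * e\<close> leaves room for the
          strict inequality.\<close>
        have split: "K f - Kn n f = K (f - g) + (K g - Kn n g) - Kn n (f - g)"
          by (simp add: linear_diff[OF linK] linear_diff[OF linKn])
        have "\<beta> * norm (K (f - g)) \<le> d" "\<beta> * norm (Kn n (f - g)) \<le> d"
          using d g(2) by (auto intro!: K_dual Kn_dual)
        then have "norm (K (f - g)) \<le> e / 4" "norm (Kn n (f - g)) \<le> e / 4"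
          using \<beta> by (simp_all add: d_def)
        moreover have "norm (K g - Kn n g) < e / 4"
          using elim g(1) by (simp add: dist_norm norm_minus_commute)
        moreover have "norm (K f - Kn n f) \<le>
            norm (K (f - g)) + norm (K g - Kn n g) + norm (Kn n (f - g))"
          unfolding split by norm
        ultimately show ?thesis by linarith
      qed
      have "onorm (\<lambda>u. K u - Kn n u) \<le> 3 / 4 * e"
      proof (rule onorm_bound)
        fix f
        show "norm (K f - Kn n f) \<le> 3 / 4 * e * norm f"
        proof (cases "f = 0")
          case False
          have "norm (K ((1 / norm f) *\<^sub>R f) - Kn n ((1 / norm f) *\<^sub>R f)) \<le> 3 / 4 * e"
            by (rule unit) simp
          then have "norm (K f - Kn n f) / norm f \<le> 3 / 4 * e"
            by (simp only: linear_scale[OF lin_diff]) simp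
          then show ?thesis using False by (simp add: pos_divide_le_eq)
        qed (simp add: linear_0[OF linK] linear_0[OF linKn])
      qed (use e in simp)
      then show ?case using e onorm_pos_le[OF bl[of n]] by simp
    qed
  qed

  have "\<forall>u v. aYO (inv A u) v = inner u v" using assms(13) Ainv by metis
  then show ?thesis
    using bij ex1 bl[unfolded K_def Kn_def] onorm_lim[unfolded K_def Kn_def]
    by (intro conjI allI) simp_all
qed

end
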